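(* Let $H$ be the graph obtained from a graph $G$ by subdividing an edge. Then $\mathrm{T}(G)=\mathrm{T}(H)$.
   Context: All graphs are finite, simple and undirected. The tree cover number $\mathrm{T}(G)$ is the minimum number of vertex-disjoint induced trees of $G$ whose vertex sets cover $V(G)$. Subdividing an edge $uv$ means deleting $uv$, adding a new vertex $w$, and adding the edges $uw$ and $wv$. *)

theory Defs
  imports "Graph_Theory.Graph_Theory"
begin

text \<open>
  Finite simple undirected graphs are the locale \<^locale>\<open>pair_graph\<close>: finite, loop-free, symmetric
  digraphs without parallel arcs, an edge \<open>uv\<close> being the pair of arcs \<open>(u,v)\<close>, \<open>(v,u)\<close>.
  Accordingly \<^const>\<open>subdivide\<close> replaces both arcs of an edge.
\<close>

text \<open>
  The library predicate \<^const>\<open>tree\<close> is unsuitable for symmetric digraphs: there the closed walk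
  \<open>u, v, u\<close> along one edge counts as a cycle. In a loop-free symmetric digraph without parallel
  arcs, the cycles of the undirected graph are exactly the digraph cycles with at least three arcs.
  \<^const>\<open>connected\<close> includes that the vertex set is nonempty.
\<close>

definition undirected_tree :: "('a, 'b) pre_digraph \<Rightarrow> bool" where
  "undirected_tree T \<longleftrightarrow> connected T \<and> \<not> (\<exists>p. pre_digraph.cycle T p \<and> 3 \<le> length p)"

definition induced_tree_cover :: "('a, 'b) pre_digraph \<Rightarrow> ('a, 'b) pre_digraph set \<Rightarrow> bool" where
  "induced_tree_cover G \<T> \<longleftrightarrow>
     (\<forall>T\<in>\<T>. induced_subgraph T G \<and> undirected_tree T) \<and>
     pairwise (\<lambda>S T. verts S \<inter> verts T = {}) \<T> \<and>
     (\<Union>T\<in>\<T>. verts T) = verts G"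

text \<open>
  For finite simple graphs the minimum is over a nonempty set, by the cover with single vertices
  (lemma \<open>induced_tree_cover_exists\<close>).
\<close>

definition tree_cover_number :: "('a, 'b) pre_digraph \<Rightarrow> nat" where
  "tree_cover_number G = (LEAST k. \<exists>\<T>. induced_tree_cover G \<T> \<and> finite \<T> \<and> card \<T> = k)"

lemma undirected_tree_single_vertex:
  assumes "loopfree_digraph G"
  shows "undirected_tree (G \<restriction> {x})"
proof -
  interpret loopfree_digraph G by fact
  have no_arcs: "arcs (G \<restriction> {x}) = {}"
    by (auto dest: no_loops)
  have "mk_symmetric (G \<restriction> {x}) = \<lparr>pverts = {x}, parcs = {}\<rparr>"
    unfolding mk_symmetric_def no_arcs by simp
  then have "connected (G \<restriction> {x})"
    by (simp add: connected_def strongly_connected_def reachable_def rtrancl_on_refl)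
  moreover have "\<not> pre_digraph.cycle (G \<restriction> {x}) p" for p
    unfolding pre_digraph.cycle_def pre_digraph.awalk_def no_arcs by simp
  ultimately show ?thesis
    by (simp add: undirected_tree_def)
qed

lemma induced_tree_cover_exists:
  assumes "pair_graph G"
  shows "\<exists>\<T>. induced_tree_cover (with_proj G) \<T> \<and> finite \<T>"
proof -
  interpret pair_graph G by fact
  let ?\<T> = "(\<lambda>x. with_proj G \<restriction> {x}) ` pverts G"
  have "induced_tree_cover (with_proj G) ?\<T>"
    unfolding induced_tree_cover_def
    using undirected_tree_single_vertex[OF loopfree_digraph_axioms] induced_induce
    by (auto simp: pairwise_def)
  then show ?thesis
    using pair_finite_verts by blast
qed

end

theory Submission
  imports Defs "HOL-Library.Disjoint_Sets"
begin

text \<open>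
  A tree is a connected graph in which every edge is a bridge. In this form, passing to or from a
  graph with a new vertex \<open>w\<close> is a matter of mapping walks along the map that sends \<open>w\<close> to a
  neighbour. A tree cover of \<open>G\<close> becomes one of \<open>H\<close> by adding \<open>w\<close> to the tree containing \<open>u\<close>:
  this tree is either subdivided or gets a new leaf. Conversely, removing \<open>w\<close> from its tree in a
  cover of \<open>H\<close> undoes one of these two operations, unless \<open>{w}\<close> is itself a tree of the cover.
  In that case the tree containing \<open>u\<close> may contain \<open>v\<close> as well, and then it is not a tree in \<open>G\<close>;
  it is split into a part with \<open>u\<close> and a part with \<open>v\<close>, the additional tree being paid for by \<open>{w}\<close>.
\<close>

section \<open>Trees described by their edge relation\<close>

definition tree_rel :: "'a set \<Rightarrow> 'a rel \<Rightarrow> bool" where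
  "tree_rel S R \<longleftrightarrow> S \<noteq> {} \<and> (\<forall>a\<in>S. \<forall>b\<in>S. (a, b) \<in> R\<^sup>*) \<and>
     (\<forall>a b. (a, b) \<in> R \<longrightarrow> (a, b) \<notin> (R - {(a, b), (b, a)})\<^sup>*)"

lemma tree_rel_bridge:
  "tree_rel S R \<Longrightarrow> (a, b) \<in> R \<Longrightarrow> (a, b) \<notin> (R - {(a, b), (b, a)})\<^sup>*"
  by (simp add: tree_rel_def)

text \<open>The tool for carrying walks between graphs: \<open>f\<close> may collapse an arc to a
  point or stretch it to a walk. Contraction of \<open>w\<close> is \<open>id(w := u)\<close>; with
  \<open>f = id\<close>, arcs are replaced by detours.\<close>

lemma rtrancl_map:
  assumes "(a, b) \<in> R\<^sup>*" and "\<And>x y. (x, y) \<in> R \<Longrightarrow> (f x, f y) \<in> Q\<^sup>*"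
  shows "(f a, f b) \<in> Q\<^sup>*"
  using assms(1) by induction (auto dest: assms(2) intro: rtrancl_trans)

text \<open>Contracting the leaf \<open>w\<close> into \<open>u\<close> turns walks of the larger
  graph into walks of \<open>R\<close>. The new edge is a bridge because \<open>w\<close> is
  isolated without it.\<close>

lemma tree_rel_pendant:
  assumes "R \<subseteq> S \<times> S" "u \<in> S" "w \<notin> S"
  shows "tree_rel (insert w S) (R \<union> {(u, w), (w, u)}) \<longleftrightarrow> tree_rel S R" (is "?L \<longleftrightarrow> ?R")
proof -
  let ?f = "id(w := u)" and ?R' = "R \<union> {(u, w), (w, u)}"
  have fresh: "x \<noteq> w" "y \<noteq> w" if "(x, y) \<in> R" for x y
    using assms that by auto
  have "u \<noteq> w" using assms by auto
  show ?thesis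
  proof
    assume L: ?L
    have "(a, b) \<in> R\<^sup>*" if "a \<in> S" "b \<in> S" for a b
    proof -
      have "(a, b) \<in> ?R'\<^sup>*" using L that by (auto simp: tree_rel_def)
      then have "(?f a, ?f b) \<in> R\<^sup>*"
        by (rule rtrancl_map) (auto dest: fresh)
      moreover have "a \<noteq> w" "b \<noteq> w" using that assms by auto
      ultimately show ?thesis by simp
    qed
    moreover have "(a, b) \<notin> (R - {(a, b), (b, a)})\<^sup>*" if "(a, b) \<in> R" for a b
    proof
      assume "(a, b) \<in> (R - {(a, b), (b, a)})\<^sup>*"
      then have "(a, b) \<in> (?R' - {(a, b), (b, a)})\<^sup>*"
        by (rule rtrancl_mono[THEN subsetD, rotated]) auto
      then show False using L that by (auto simp: tree_rel_def)
    qed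
    ultimately show ?R using assms by (auto simp: tree_rel_def)
  next
    assume R: ?R
    have S: "(a, b) \<in> ?R'\<^sup>*" if "a \<in> S" "b \<in> S" for a b
      using R that rtrancl_mono[of R ?R'] by (auto simp: tree_rel_def)
    have "(a, u) \<in> ?R'\<^sup>* \<and> (u, a) \<in> ?R'\<^sup>*" if "a \<in> insert w S" for a
      using that S assms(2) by auto
    then have "(a, b) \<in> ?R'\<^sup>*" if "a \<in> insert w S" "b \<in> insert w S" for a b
      using that by (meson rtrancl_trans)
    moreover have "(a, b) \<notin> (?R' - {(a, b), (b, a)})\<^sup>*" if ab: "(a, b) \<in> ?R'" for a b
    proof
      assume *: "(a, b) \<in> (?R' - {(a, b), (b, a)})\<^sup>*"
      show False
      proof (cases "(a, b) \<in> R")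
        case True
        from * have "(?f a, ?f b) \<in> (R - {(a, b), (b, a)})\<^sup>*"
          by (rule rtrancl_map) (auto dest: fresh)
        then show False using True R fresh[OF True] by (auto simp: tree_rel_def)
      next
        case False
        \<comment> \<open>Once the new edge is removed only arcs of \<open>R\<close> remain. A walk
          between the distinct vertices \<open>u\<close> and \<open>w\<close> would have to begin or
          end with an arc at \<open>w\<close>.\<close>
        then have "(a = u \<and> b = w) \<or> (a = w \<and> b = u)" using ab by auto
        moreover from this have "?R' - {(a, b), (b, a)} \<subseteq> R" by auto
        ultimately have "(u, w) \<in> R\<^sup>* \<or> (w, u) \<in> R\<^sup>*"
          using * rtrancl_mono by blast
        then show False
          using fresh \<open>u \<noteq> w\<close> by (metis converse_rtranclE rtranclE)
      qed
    qed
    ultimately show ?L by (auto simp: tree_rel_def)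
  qed
qed

text \<open>Walks go down by contracting \<open>w\<close> and go up by the detour through
  \<open>w\<close>. For bridges, old edges other than \<open>uv\<close> correspond to themselves,
  and \<open>uv\<close> corresponds to each of the two halves.\<close>

lemma tree_rel_subdivide:
  assumes "R \<subseteq> S \<times> S" "(u, v) \<in> R" "(v, u) \<in> R" "u \<noteq> v" "w \<notin> S"
  shows "tree_rel (insert w S) (R - {(u, v), (v, u)} \<union> {(u, w), (w, u), (w, v), (v, w)})
    \<longleftrightarrow> tree_rel S R" (is "tree_rel _ ?R' \<longleftrightarrow> _")
proof -
  have fresh: "x \<noteq> w" "y \<noteq> w" if "(x, y) \<in> R" for x y
    using assms that by auto
  have uvw: "u \<noteq> w" "v \<noteq> w" "u \<in> S" "v \<in> S" using assms by auto
  show ?thesis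
  proof
    assume L: "tree_rel (insert w S) ?R'"
    have "(a, b) \<in> R\<^sup>*" if "a \<in> S" "b \<in> S" for a b
    proof -
      have "(a, b) \<in> ?R'\<^sup>*" using L that by (auto simp: tree_rel_def)
      then have "((id(w := u)) a, (id(w := u)) b) \<in> R\<^sup>*"
        using assms(2,3) by (rule_tac rtrancl_map) (auto dest: fresh)
      moreover have "a \<noteq> w" "b \<noteq> w" using that assms by auto
      ultimately show ?thesis by simp
    qed
    moreover have "(a, b) \<notin> (R - {(a, b), (b, a)})\<^sup>*" if ab: "(a, b) \<in> R" for a b
    proof
      assume *: "(a, b) \<in> (R - {(a, b), (b, a)})\<^sup>*"
      show False
      proof (cases "(a, b) \<in> {(u, v), (v, u)}")
        case True
        \<comment> \<open>The walk around the edge \<open>uv\<close> misses \<open>w\<close>.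
          Prolonged by the arc from \<open>b\<close> to \<open>w\<close>, it bypasses the half edge
          between \<open>a\<close> and \<open>w\<close>.\<close>
        with * have "(a, b) \<in> (?R' - {(a, w), (w, a)})\<^sup>*"
          by (elim rtrancl_mono[THEN subsetD, rotated]) (auto dest: fresh)
        moreover have "(b, w) \<in> ?R' - {(a, w), (w, a)}"
          using True uvw assms(4) by auto
        ultimately have "(a, w) \<in> (?R' - {(a, w), (w, a)})\<^sup>*"
          by (rule rtrancl_into_rtrancl)
        then show False using L True by (auto simp: tree_rel_def)
      next
        case False
        \<comment> \<open>As \<open>a\<close> and \<open>b\<close> differ from \<open>w\<close>,
          deleting the edge \<open>ab\<close> leaves the detour between \<open>u\<close> and
          \<open>v\<close> through \<open>w\<close> intact.\<close>
        have "(u, v) \<in> (?R' - {(a, b), (b, a)})\<^sup>*" "(v, u) \<in> (?R' - {(a, b), (b, a)})\<^sup>*"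
          by (rule rtrancl_trans[of _ w]; use fresh[OF ab] in auto)+
        then have "(x, y) \<in> (?R' - {(a, b), (b, a)})\<^sup>*" if "(x, y) \<in> R - {(a, b), (b, a)}" for x y
          using that by (cases "(x, y) \<in> {(u, v), (v, u)}") auto
        then have "(a, b) \<in> (?R' - {(a, b), (b, a)})\<^sup>*"
          using rtrancl_map[OF *, of id] by simp
        then show False using L ab False by (auto simp: tree_rel_def)
      qed
    qed
    ultimately show "tree_rel S R" using uvw by (auto simp: tree_rel_def)
  next
    assume R: "tree_rel S R"
    have uv: "(u, v) \<in> ?R'\<^sup>*" "(v, u) \<in> ?R'\<^sup>*"
      by (rule rtrancl_trans[of _ w]; auto)+
    have S: "(a, b) \<in> ?R'\<^sup>*" if "a \<in> S" "b \<in> S" for a b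
    proof -
      have "(a, b) \<in> R\<^sup>*" using R that by (auto simp: tree_rel_def)
      then show ?thesis using uv rtrancl_map[of a b R id ?R'] by auto
    qed
    have "(a, u) \<in> ?R'\<^sup>* \<and> (u, a) \<in> ?R'\<^sup>*" if "a \<in> insert w S" for a
      using that S uvw(3) by auto
    then have "(a, b) \<in> ?R'\<^sup>*" if "a \<in> insert w S" "b \<in> insert w S" for a b
      using that by (meson rtrancl_trans)
    moreover have "(a, b) \<notin> (?R' - {(a, b), (b, a)})\<^sup>*" if ab: "(a, b) \<in> ?R'" for a b
    proof
      assume *: "(a, b) \<in> (?R' - {(a, b), (b, a)})\<^sup>*"
      show False
      proof (cases "(a, b) \<in> R")
        case True
        with ab have "(a, b) \<notin> {(u, v), (v, u)}" using fresh by auto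
        with * have "((id(w := u)) a, (id(w := u)) b) \<in> (R - {(a, b), (b, a)})\<^sup>*"
          using assms(2,3) by (elim rtrancl_map) (auto dest: fresh)
        then show False using True R fresh[OF True] by (auto simp: tree_rel_def)
      next
        case False
        \<comment> \<open>The deleted edge joins \<open>w\<close> to the endpoint \<open>c\<close>,
          and \<open>d\<close> is the other endpoint. Contracting \<open>w\<close> into
          \<open>d\<close> collapses the remaining half edge, so the walk becomes one between
          \<open>c\<close> and \<open>d\<close> that avoids \<open>uv\<close>.\<close>
        define c where "c = (if a = w then b else a)"
        define d where "d = (if c = u then v else u)"
        have c: "c = u \<and> d = v \<or> c = v \<and> d = u" and abc: "a = c \<and> b = w \<or> a = w \<and> b = c"
          using ab False assms(4) uvw by (auto simp: c_def d_def)
        from * have "((id(w := d)) a, (id(w := d)) b) \<in> (R - {(u, v), (v, u)})\<^sup>*"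
          using c abc by (elim rtrancl_map) (auto dest: fresh)
        then have "(c, d) \<in> (R - {(c, d), (d, c)})\<^sup>* \<or> (d, c) \<in> (R - {(d, c), (c, d)})\<^sup>*"
          using c abc uvw by (auto simp: insert_commute)
        then show False
          using c assms(2,3) tree_rel_bridge[OF R] by blast
      qed
    qed
    ultimately show "tree_rel (insert w S) ?R'" unfolding tree_rel_def by blast
  qed
qed

text \<open>Removing \<open>u\<close> and taking the component of \<open>v\<close> leaves a
  connected rest, since every walk from that component to the rest passes through \<open>u\<close>.
  Bridges remain bridges in induced subgraphs.\<close>

lemma tree_rel_split:
  assumes "tree_rel S (E \<inter> S \<times> S)" "sym E" "u \<in> S" "v \<in> S" "u \<noteq> v"
  obtains C where "C \<subseteq> S" "v \<in> C" "u \<notin> C"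
    "tree_rel C (E \<inter> C \<times> C)" "tree_rel (S - C) (E \<inter> (S - C) \<times> (S - C))"
proof -
  let ?Q = "E \<inter> (S - {u}) \<times> (S - {u})"
  \<comment> \<open>the component of \<open>v\<close> in the tree without \<open>u\<close>\<close>
  define C where "C = {x. (v, x) \<in> ?Q\<^sup>*}"
  have bridge: "(a, b) \<notin> (E \<inter> A \<times> A - {(a, b), (b, a)})\<^sup>*"
    if "A \<subseteq> S" "(a, b) \<in> E \<inter> A \<times> A" for a b A
  proof
    assume "(a, b) \<in> (E \<inter> A \<times> A - {(a, b), (b, a)})\<^sup>*"
    then have "(a, b) \<in> (E \<inter> S \<times> S - {(a, b), (b, a)})\<^sup>*"
      using that by (elim rtrancl_mono[THEN subsetD, rotated]) auto
    moreover have "(a, b) \<in> E \<inter> S \<times> S" using that by auto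
    ultimately show False using tree_rel_bridge[OF assms(1)] by simp
  qed
  have "v \<in> C" by (simp add: C_def)
  have "x \<in> S - {u}" if "(v, x) \<in> ?Q\<^sup>*" for x
    using that by (rule rtranclE) (use assms(4,5) in auto)
  then have C: "C \<subseteq> S" "u \<notin> C" unfolding C_def by blast+
  have vC: "(v, x) \<in> (E \<inter> C \<times> C)\<^sup>*" if "(v, x) \<in> ?Q\<^sup>*" for x
    using that
  proof induction
    case (step y z)
    then have "(y, z) \<in> E \<inter> C \<times> C" by (auto simp: C_def intro: rtrancl_into_rtrancl)
    with step.IH show ?case by (rule rtrancl_into_rtrancl)
  qed simp
  have sym_r: "sym ((E \<inter> A \<times> A)\<^sup>*)" for A
    using \<open>sym E\<close> by (intro sym_rtrancl) (auto simp: sym_def)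
  have "(a, b) \<in> (E \<inter> C \<times> C)\<^sup>*" if "a \<in> C" "b \<in> C" for a b
  proof -
    have "(v, a) \<in> (E \<inter> C \<times> C)\<^sup>*" "(v, b) \<in> (E \<inter> C \<times> C)\<^sup>*"
      using that vC unfolding C_def by blast+
    then show ?thesis using symD[OF sym_r] rtrancl_trans by metis
  qed
  then have tree_C: "tree_rel C (E \<inter> C \<times> C)"
    using bridge[OF C(1)] \<open>v \<in> C\<close> unfolding tree_rel_def by blast
  let ?D = "S - C"
  \<comment> \<open>Induction along a walk from \<open>u\<close>: at a return to \<open>u\<close>
    the earlier part is discarded. Any other vertex outside \<open>C\<close> has its predecessor
    outside \<open>C\<close> too, because \<open>C\<close> is closed under arcs avoiding
    \<open>u\<close>.\<close>
  have uD: "(u, x) \<in> (E \<inter> ?D \<times> ?D)\<^sup>*" if "(u, x) \<in> (E \<inter> S \<times> S)\<^sup>*" "x \<notin> C" for x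
    using that
  proof induction
    case (step y z)
    show ?case
    proof (cases "z = u")
      case False
      have "y \<notin> C"
      proof
        assume "y \<in> C"
        with C False step.hyps have "(y, z) \<in> ?Q" by auto
        with \<open>y \<in> C\<close> have "z \<in> C" by (auto simp: C_def intro: rtrancl_into_rtrancl)
        with step.prems show False ..
      qed
      then have "(y, z) \<in> E \<inter> ?D \<times> ?D" using step by auto
      with step.IH[OF \<open>y \<notin> C\<close>] show ?thesis by (rule rtrancl_into_rtrancl)
    qed simp
  qed simp
  have "(u, x) \<in> (E \<inter> ?D \<times> ?D)\<^sup>*" if "x \<in> ?D" for x
  proof -
    have "(u, x) \<in> (E \<inter> S \<times> S)\<^sup>*"
      using assms(1,3) that unfolding tree_rel_def by blast
    then show ?thesis using uD that by blast
  qed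
  then have "(a, b) \<in> (E \<inter> ?D \<times> ?D)\<^sup>*" if "a \<in> ?D" "b \<in> ?D" for a b
    using that symD[OF sym_r] rtrancl_trans by metis
  then have "tree_rel ?D (E \<inter> ?D \<times> ?D)"
    using bridge[of ?D] C assms(3) unfolding tree_rel_def by blast
  then show thesis
    using that C \<open>v \<in> C\<close> tree_C by blast
qed

section \<open>Agreement with the trees of the digraph library\<close>

text \<open>A path around an edge closes up with that edge to a cycle, and a cycle without its first
  arc is a walk around that arc. The length bound rules out running back and forth along one
  edge.\<close>

lemma (in pair_bidirected_digraph) no_cycle_iff_bridges:
  "\<not> (\<exists>p. cycle p \<and> 3 \<le> length p) \<longleftrightarrow>
    (\<forall>a b. (a, b) \<in> parcs G \<longrightarrow> (a, b) \<notin> (parcs G - {(a, b), (b, a)})\<^sup>*)" (is "?L \<longleftrightarrow> ?R")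
proof
  assume L: ?L
  show ?R
  proof (intro allI impI notI)
    fix a b assume ab: "(a, b) \<in> parcs G" and r: "(a, b) \<in> (parcs G - {(a, b), (b, a)})\<^sup>*"
    define D where "D = \<lparr>pverts = pverts G, parcs = parcs G - {(a, b), (b, a)}\<rparr>"
    interpret D: pair_wf_digraph D
      by unfold_locales (auto simp: D_def wellformed')
    have "a \<in> pverts D" using ab by (auto simp: D_def wellformed')
    have D_arcs: "parcs D = parcs G - {(a, b), (b, a)}" and D_verts: "pverts D = pverts G"
      by (simp_all add: D_def)
    with \<open>a \<in> pverts D\<close> have "a \<rightarrow>\<^sup>*\<^bsub>D\<^esub> b" using r D.reachable_conv' by metis
    then obtain p where p: "D.apath a p b" using D.reachable_apath by blast
    then have "awalk a p b" and pD: "set p \<subseteq> parcs D" and dist: "distinct (awalk_verts a p)"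
      using p by (auto simp: D.apath_def D.awalk_def awalk_def D_arcs D_verts)
    then have "awalk b ((b, a) # p) b"
      using ab arcs_symmetric by (auto simp: awalk_Cons_iff)
    then have "cycle ((b, a) # p)"
      using dist by (auto simp: cycle_def)
    \<comment> \<open>The path is nonempty since there are no loops, and its only possible form with
      one arc is the deleted arc \<open>(a, b)\<close>.\<close>
    moreover have "2 \<le> length p"
    proof -
      have "a \<noteq> b" using ab no_loops' by auto
      moreover have "p \<noteq> [(a, b)]" using pD by (auto simp: D_def)
      ultimately show ?thesis
        using \<open>awalk a p b\<close> by (cases p; cases "tl p") (auto simp: awalk_simps)
    qed
    ultimately show False using L by (metis One_nat_def Suc_1 Suc_le_mono length_Cons numeral_3_eq_3)
  qed
next
  assume R: ?R
  show ?L
  proof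
    assume "\<exists>p. cycle p \<and> 3 \<le> length p"
    then obtain p u where p: "awalk u p u" "distinct (tl (awalk_verts u p))" "3 \<le> length p"
      by (auto simp: cycle_def)
    then obtain a b q where pq: "p = (a, b) # q" by (cases p) auto
    with p have ab: "(a, b) \<in> parcs G" and q: "awalk b q a" "distinct (awalk_verts b q)" "2 \<le> length q"
      by (auto simp: awalk_Cons_iff)
    \<comment> \<open>The second arc of \<open>q\<close> excludes \<open>(b, a)\<close>: only the
      first arc of \<open>q\<close> starts in \<open>b\<close>, and its head \<open>x\<close> is the
      tail of the next arc, whereas \<open>a\<close> is not a tail in \<open>q\<close>.\<close>
    obtain x y q' where q': "q = (b, x) # (x, y) # q'"
      using q by (cases q; cases "tl q") (auto simp: awalk_simps)
    have v1: "awalk_verts b q = b # map snd q"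
      using awalk_verts_conv'[of b q a] q(1) q' by auto
    have v2: "awalk_verts b q = map fst q @ [a]"
      using awalk_verts_conv[of b q] q(1) q' by (auto simp: awalk_verts_conv)
    have "b \<notin> snd ` set q"
      using q(2) unfolding v1 by auto
    moreover have "distinct (map fst q @ [a])"
      using q(2) v2 by simp
    then have "a \<notin> fst ` set q" "b \<notin> fst ` set ((x, y) # q')"
      using q' by auto
    ultimately have "(a, b) \<notin> set q" "(b, a) \<notin> set q"
      using q' by force+
    then have "set q \<subseteq> parcs G - {(b, a), (a, b)}" using q by auto
    moreover have "(z, a) \<in> F\<^sup>*" if "awalk z r a" "set r \<subseteq> F" for z r and F :: "'a rel"
      using that by (induction r arbitrary: z) (auto simp: awalk_simps intro: converse_rtrancl_into_rtrancl)
    ultimately have "(b, a) \<in> (parcs G - {(b, a), (a, b)})\<^sup>*"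
      using q(1) by blast
    then show False using R ab arcs_symmetric by blast
  qed
qed

lemma (in pair_bidirected_digraph) undirected_tree_iff_tree_rel:
  "undirected_tree (with_proj G) \<longleftrightarrow> tree_rel (pverts G) (parcs G)"
proof -
  \<comment> \<open>\<open>connected\<close> refers to the symmetric closure of the arcs, which adds
    nothing in a symmetric digraph.\<close>
  have "(parcs G)\<^sup>s = parcs G"
    by (auto simp: symcl_def intro: arcs_symmetric)
  then have "connected (with_proj G) \<longleftrightarrow>
      pverts G \<noteq> {} \<and> (\<forall>a\<in>pverts G. \<forall>b\<in>pverts G. (a, b) \<in> (parcs G)\<^sup>*)"
    using reachable_conv' by (simp add: connected_conv reachable_def)
  then show ?thesis
    using no_cycle_iff_bridges by (simp add: undirected_tree_def tree_rel_def)
qed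

lemma (in pair_bidirected_digraph) undirected_tree_induce_iff:
  "undirected_tree (with_proj G \<restriction> S) \<longleftrightarrow> tree_rel S (parcs G \<inter> S \<times> S)"
proof -
  let ?K = "\<lparr>pverts = S, parcs = parcs G \<inter> S \<times> S\<rparr>"
  have "pair_bidirected_digraph ?K"
    using arcs_symmetric no_loops'
    by unfold_locales (auto simp: symmetric_def sym_def)
  then interpret K: pair_bidirected_digraph ?K .
  have "with_proj G \<restriction> S = with_proj ?K"
    by (auto simp: induce_subgraph_def with_proj_def)
  then show ?thesis
    using K.undirected_tree_iff_tree_rel by simp
qed

section \<open>Tree covers as vertex partitions\<close>

text \<open>An induced subgraph is determined by its vertex set, so a cover can be recorded by its
  vertex sets alone. Trees are nonempty, which matches the nonempty blocks of
  \<open>partition_on\<close>.\<close>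

definition tree_partition :: "'a rel \<Rightarrow> 'a set \<Rightarrow> 'a set set \<Rightarrow> bool" where
  "tree_partition E V P \<longleftrightarrow> partition_on V P \<and> (\<forall>S\<in>P. tree_rel S (E \<inter> S \<times> S))"

text \<open>Taking vertex sets and inducing subgraphs are injective on covers and partitions
  respectively, so both preserve the number of trees.\<close>

lemma (in pair_graph) tree_cover_iff_tree_partition:
  "(\<exists>\<T>. induced_tree_cover (with_proj G) \<T> \<and> finite \<T> \<and> card \<T> = k) \<longleftrightarrow>
    (\<exists>P. tree_partition (parcs G) (pverts G) P \<and> card P = k)"
proof
  assume "\<exists>\<T>. induced_tree_cover (with_proj G) \<T> \<and> finite \<T> \<and> card \<T> = k"
  then obtain \<T> where cov: "induced_tree_cover (with_proj G) \<T>" and card: "card \<T> = k" by blast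
  have ind: "with_proj G \<restriction> verts T = T" if "T \<in> \<T>" for T
    using that cov induce_eq_iff_induced by (auto simp: induced_tree_cover_def)
  then have tree: "tree_rel (verts T) (parcs G \<inter> verts T \<times> verts T)" if "T \<in> \<T>" for T
    using that cov by (metis induced_tree_cover_def undirected_tree_induce_iff)
  then have ne: "verts T \<noteq> {}" if "T \<in> \<T>" for T
    using that by (auto simp: tree_rel_def)
  have "inj_on verts \<T>"
    by (metis ind inj_onI)
  then have "card (verts ` \<T>) = k"
    using card by (simp add: card_image)
  moreover have "partition_on (pverts G) (verts ` \<T>)"
    unfolding partition_on_def
  proof (intro conjI)
    show "\<Union>(verts ` \<T>) = pverts G"
      using cov by (simp add: induced_tree_cover_def)
    show "disjoint (verts ` \<T>)"
      using cov unfolding induced_tree_cover_def pairwise_def disjnt_def by (metis (no_types) imageE)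
    show "{} \<notin> verts ` \<T>"
      using ne by (metis imageE)
  qed
  ultimately have "tree_partition (parcs G) (pverts G) (verts ` \<T>) \<and> card (verts ` \<T>) = k"
    using tree unfolding tree_partition_def by blast
  then show "\<exists>P. tree_partition (parcs G) (pverts G) P \<and> card P = k" by blast
next
  let ?ind = "induce_subgraph (with_proj G)"
  assume "\<exists>P. tree_partition (parcs G) (pverts G) P \<and> card P = k"
  then obtain P where part: "partition_on (pverts G) P"
    and tree: "\<And>S. S \<in> P \<Longrightarrow> tree_rel S (parcs G \<inter> S \<times> S)" and card: "card P = k"
    by (auto simp: tree_partition_def)
  have "finite P" using part pair_finite_verts finite_elements by blast
  have "inj_on ?ind P"
    by (metis inj_onI induce_subgraph_verts)
  then have "card (?ind ` P) = k" using card by (simp add: card_image)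
  moreover have "induced_tree_cover (with_proj G) (?ind ` P)"
    unfolding induced_tree_cover_def
  proof (intro conjI ballI)
    fix T assume "T \<in> ?ind ` P"
    then obtain S where S: "S \<in> P" "T = ?ind S" by blast
    have "S \<subseteq> pverts G" using S(1) part unfolding partition_on_def by blast
    then show "induced_subgraph T (with_proj G)" using S(2) induced_induce by simp
    show "undirected_tree T" using S tree undirected_tree_induce_iff by simp
  next
    show "pairwise (\<lambda>S T. verts S \<inter> verts T = {}) (?ind ` P)"
      using part unfolding partition_on_def pairwise_def disjnt_def
      by (metis imageE induce_subgraph_verts)
    show "(\<Union>T\<in>?ind ` P. verts T) = verts (with_proj G)"
      using part by (simp add: partition_on_def)
  qed
  ultimately show "\<exists>\<T>. induced_tree_cover (with_proj G) \<T> \<and> finite \<T> \<and> card \<T> = k"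
    using \<open>finite P\<close> by blast
qed

lemma (in pair_graph) tree_cover_number_le:
  assumes "tree_partition (parcs G) (pverts G) P"
  shows "tree_cover_number (with_proj G) \<le> card P"
  unfolding tree_cover_number_def tree_cover_iff_tree_partition
  by (rule Least_le) (use assms in blast)

lemma (in pair_graph) tree_cover_number_attained:
  obtains P where "tree_partition (parcs G) (pverts G) P" "card P = tree_cover_number (with_proj G)"
proof -
  have "\<exists>k \<T>. induced_tree_cover (with_proj G) \<T> \<and> finite \<T> \<and> card \<T> = k"
    using induced_tree_cover_exists[OF pair_graph] by blast
  from LeastI_ex[OF this] have "\<exists>\<T>. induced_tree_cover (with_proj G) \<T> \<and> finite \<T> \<and>
      card \<T> = tree_cover_number (with_proj G)"
    unfolding tree_cover_number_def .
  then show thesis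
    unfolding tree_cover_iff_tree_partition using that by (elim exE conjE)
qed

text \<open>Covers all changes of a partition made below: a block gains \<open>w\<close>, loses
  \<open>w\<close>, disappears (\<open>B\<close> and \<open>Q\<close> empty) or is split in
  two.\<close>

lemma partition_on_replace:
  assumes "partition_on V P" "A \<in> P" "partition_on B Q" "B \<inter> (V - A) = {}" "W = V - A \<union> B"
  shows "partition_on W (P - {A} \<union> Q)"
proof -
  have disj: "S \<inter> T = {}" if "S \<in> P" "T \<in> P" "S \<noteq> T" for S T
    using assms(1) that unfolding partition_on_def disjoint_def by blast
  have Un: "\<Union>(P - {A}) = V - A"
    using assms(1,2) disj unfolding partition_on_def by blast
  have disj': "S \<inter> T = {}" if "S \<in> P - {A}" "T \<in> Q" for S T
  proof -
    have "S \<subseteq> V - A" using that(1) Un by blast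
    moreover have "T \<subseteq> B" using that(2) assms(3) unfolding partition_on_def by blast
    ultimately show ?thesis using assms(4) by blast
  qed
  show ?thesis
    unfolding partition_on_def
  proof (intro conjI)
    show "\<Union>(P - {A} \<union> Q) = W"
      using Un assms(3,5) unfolding partition_on_def by (metis Union_Un_distrib)
    show "disjoint (P - {A} \<union> Q)"
      using disj disj' assms(3) unfolding partition_on_def disjoint_def
      by (metis Diff_iff Int_commute Un_iff)
    show "{} \<notin> P - {A} \<union> Q"
      using assms(1,3) unfolding partition_on_def by blast
  qed
qed

lemma card_replace_le:
  assumes "finite P" "A \<in> P"
  shows "card (P - {A} \<union> Q) + 1 \<le> card P + card Q"
  using card_Un_le[of "P - {A}" Q] card.remove[OF assms] by simp

section \<open>Transfer of tree partitions along the subdivision\<close>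

locale edge_subdivision =
  fixes E :: "'a rel" and V :: "'a set" and u v w :: 'a
  assumes finite_V: "finite V" and sym: "sym E" and subset: "E \<subseteq> V \<times> V"
    and edge: "(u, v) \<in> E" and neq: "u \<noteq> v" and fresh: "w \<notin> V"
begin

definition subdivided :: "'a rel" where
  "subdivided = E - {(u, v), (v, u)} \<union> {(u, w), (w, u), (w, v), (v, w)}"

lemma endpoints: "u \<in> V" "v \<in> V" "(v, u) \<in> E"
  using edge subset sym by (auto dest: symD)

text \<open>Among old vertices the two graphs differ only in the edge \<open>uv\<close>, so a block
  missing one endpoint induces the same subgraph in both.\<close>

lemma restrict_subdivided:
  "A \<subseteq> V \<Longrightarrow> u \<notin> A \<or> v \<notin> A \<Longrightarrow> subdivided \<inter> A \<times> A = E \<inter> A \<times> A"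
  using fresh by (auto simp: subdivided_def)

text \<open>If \<open>A\<close> contains both endpoints, then \<open>w\<close> subdivides an edge of
  the induced subgraph; if it contains just one, then \<open>w\<close> is a new leaf there.\<close>

lemma tree_rel_insert_iff:
  assumes "A \<subseteq> V" "u \<in> A \<or> v \<in> A"
  shows "tree_rel (insert w A) (subdivided \<inter> insert w A \<times> insert w A) \<longleftrightarrow> tree_rel A (E \<inter> A \<times> A)"
    (is "tree_rel _ ?S \<longleftrightarrow> tree_rel _ ?E")
proof -
  have "w \<notin> A" using assms fresh by auto
  have E: "x \<noteq> w" "y \<noteq> w" if "(x, y) \<in> E" for x y
    using assms that fresh subset by auto
  consider "u \<in> A" "v \<in> A" | "u \<in> A" "v \<notin> A" | "v \<in> A" "u \<notin> A" using assms by auto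
  then show ?thesis
  proof cases
    case 1
    then have "?S = ?E - {(u, v), (v, u)} \<union> {(u, w), (w, u), (w, v), (v, w)}"
      using E by (auto simp: subdivided_def)
    then show ?thesis
      using 1 tree_rel_subdivide[of ?E A u v w] edge neq endpoints fresh assms by auto
  next
    case 2
    then have "?S = ?E \<union> {(u, w), (w, u)}"
      using E neq endpoints fresh by (auto simp: subdivided_def)
    then show ?thesis
      using 2 tree_rel_pendant[of ?E A u w] fresh assms by auto
  next
    case 3
    then have "?S = ?E \<union> {(v, w), (w, v)}"
      using E neq endpoints fresh by (auto simp: subdivided_def)
    then show ?thesis
      using 3 tree_rel_pendant[of ?E A v w] fresh assms by auto
  qed
qed

lemma tree_partition_subdivided:
  assumes "tree_partition E V P"
  shows "\<exists>Q. tree_partition subdivided (insert w V) Q \<and> card Q \<le> card P"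
proof -
  have part: "partition_on V P" and tree: "\<And>S. S \<in> P \<Longrightarrow> tree_rel S (E \<inter> S \<times> S)"
    using assms by (auto simp: tree_partition_def)
  have "finite P" using part finite_V finite_elements by blast
  obtain A where A: "A \<in> P" "u \<in> A" using part endpoints by (auto simp: partition_on_def)
  have sub: "S \<subseteq> V" if "S \<in> P" for S
    using part that unfolding partition_on_def by blast
  have disj: "S \<inter> A = {}" if "S \<in> P - {A}" for S
    using part that A unfolding partition_on_def disjoint_def by blast
  let ?Q = "P - {A} \<union> {insert w A}"
  have "partition_on (insert w A) {insert w A}"
    by (simp add: partition_on_space)
  moreover have "insert w A \<inter> (V - A) = {}" "insert w V = V - A \<union> insert w A"
    using fresh sub[OF A(1)] by auto
  ultimately have "partition_on (insert w V) ?Q"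
    by (rule partition_on_replace[OF part A(1)])
  moreover have "tree_rel S (subdivided \<inter> S \<times> S)" if "S \<in> P - {A}" for S
  proof -
    \<comment> \<open>The block \<open>A\<close> already holds \<open>u\<close>, so no other block
      can contain the whole edge \<open>uv\<close>.\<close>
    have "u \<notin> S" using disj[OF that] A by auto
    then show ?thesis using that tree[of S] sub[of S] restrict_subdivided[of S] by simp
  qed
  moreover have "tree_rel (insert w A) (subdivided \<inter> insert w A \<times> insert w A)"
    using tree_rel_insert_iff[of A] A sub tree by simp
  ultimately have "tree_partition subdivided (insert w V) ?Q"
    unfolding tree_partition_def by blast
  moreover have "card ?Q \<le> card P"
    using card_replace_le[OF \<open>finite P\<close> A(1), of "{insert w A}"] by simp
  ultimately show ?thesis by blast
qed

lemma tree_partition_unsubdivided: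
  assumes "tree_partition subdivided (insert w V) P"
  shows "\<exists>Q. tree_partition E V Q \<and> card Q \<le> card P"
proof -
  have part: "partition_on (insert w V) P"
    and tree: "\<And>S. S \<in> P \<Longrightarrow> tree_rel S (subdivided \<inter> S \<times> S)"
    using assms by (auto simp: tree_partition_def)
  have "finite P" using part finite_V finite_elements[of "insert w V"] by blast
  obtain A where A: "A \<in> P" "w \<in> A" using part by (auto simp: partition_on_def)
  have disj: "S \<inter> T = {}" if "S \<in> P" "T \<in> P" "S \<noteq> T" for S T
    using part that unfolding partition_on_def disjoint_def by blast
  have sub: "S \<subseteq> V" if "S \<in> P - {A}" for S
  proof -
    have "S \<subseteq> insert w V" using part that unfolding partition_on_def by blast
    moreover have "w \<notin> S" using disj[of S A] that A by blast
    ultimately show ?thesis by blast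
  qed
  have treeE: "tree_rel S (E \<inter> S \<times> S)" if "S \<in> P - {A}" "u \<notin> S \<or> v \<notin> S" for S
    using that tree[of S] sub[of S] restrict_subdivided[of S] by simp
  show ?thesis
  proof (cases "A = {w}")
    case False
    then obtain x where x: "x \<in> A" "x \<noteq> w" using A by auto
    \<comment> \<open>Connectedness of a block with a further vertex provides a neighbour of
      \<open>w\<close> inside it, which must be \<open>u\<close> or \<open>v\<close>.\<close>
    then have "(w, x) \<in> (subdivided \<inter> A \<times> A)\<^sup>*"
      using tree[OF A(1)] A(2) unfolding tree_rel_def by blast
    then obtain y where "(w, y) \<in> subdivided" "y \<in> A"
      using x(2) by (metis Int_iff SigmaD2 converse_rtranclE)
    then have uvA: "u \<in> A - {w} \<or> v \<in> A - {w}"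
      using subset fresh endpoints by (auto simp: subdivided_def)
    have AV: "A - {w} \<subseteq> V" using part A unfolding partition_on_def by blast
    have "insert w (A - {w}) = A" using A by auto
    then have "tree_rel (A - {w}) (E \<inter> (A - {w}) \<times> (A - {w}))"
      using tree_rel_insert_iff[OF AV uvA] tree[OF A(1)] by simp
    moreover have "tree_rel S (E \<inter> S \<times> S)" if "S \<in> P - {A}" for S
      using that treeE[of S] uvA disj[of S A] A by blast
    moreover have "partition_on V (P - {A} \<union> {A - {w}})"
    proof (rule partition_on_replace[OF part A(1)])
      show "partition_on (A - {w}) {A - {w}}" using x by (auto intro: partition_on_space)
    qed (use A AV fresh in auto)
    ultimately have "tree_partition E V (P - {A} \<union> {A - {w}})"
      unfolding tree_partition_def by blast
    then show ?thesis
      using card_replace_le[OF \<open>finite P\<close> A(1), of "{A - {w}}"] by force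
  next
    case True
    \<comment> \<open>Dropping the block \<open>{w}\<close> leaves a partition of the old vertices
      with one block to spare.\<close>
    have "partition_on V (P - {A} \<union> {})"
      by (rule partition_on_replace[OF part A(1) partition_on_empty[THEN iffD2, OF refl]])
        (use True fresh in auto)
    then have partV: "partition_on V (P - {A})" by simp
    then obtain B where B: "B \<in> P - {A}" "u \<in> B"
      using endpoints by (auto simp: partition_on_def)
    have other: "tree_rel S (E \<inter> S \<times> S)" if "S \<in> P - {A} - {B}" for S
      using that treeE[of S] disj[of S B] B by blast
    have card: "card (P - {A}) + 1 = card P"
      using card.remove[OF \<open>finite P\<close> A(1)] by simp
    show ?thesis
    proof (cases "v \<in> B")
      case False
      \<comment> \<open>With \<open>u\<close> and \<open>v\<close> in different blocks, restoring
        the edge \<open>uv\<close> affects no induced subgraph.\<close>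
      then have "tree_partition E V (P - {A})"
        using partV treeE[OF B(1)] other unfolding tree_partition_def by blast
      then show ?thesis using card by (intro exI[of _ "P - {A}"]) simp
    next
      case True
      \<comment> \<open>Here the edge \<open>uv\<close> would close a cycle in \<open>B\<close>. The
        split is made in the subdivided graph, and each part misses one endpoint, so it is a tree in
        the original graph as well.\<close>
      have "sym subdivided" using sym by (auto simp: subdivided_def sym_def)
      then obtain C where C: "C \<subseteq> B" "v \<in> C" "u \<notin> C"
        "tree_rel C (subdivided \<inter> C \<times> C)"
        "tree_rel (B - C) (subdivided \<inter> (B - C) \<times> (B - C))"
        using tree_rel_split[of B subdivided u v] True B tree[of B] neq by blast
      then have "tree_rel C (E \<inter> C \<times> C)" "tree_rel (B - C) (E \<inter> (B - C) \<times> (B - C))"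
        using sub[OF B(1)] restrict_subdivided[of C] restrict_subdivided[of "B - C"] by fastforce+
      moreover have "partition_on V (P - {A} - {B} \<union> {C, B - C})"
      proof (rule partition_on_replace[OF partV B(1)])
        show "partition_on B {C, B - C}"
          unfolding partition_on_def
        proof (intro conjI)
          show "\<Union>{C, B - C} = B" using C(1) by auto
          show "disjoint {C, B - C}" by (auto simp: pairwise_insert disjnt_def)
          show "{} \<notin> {C, B - C}" using C(2,3) B(2) by auto
        qed
      qed (use sub[OF B(1)] in auto)
      ultimately have "tree_partition E V (P - {A} - {B} \<union> {C, B - C})"
        using other unfolding tree_partition_def by blast
      moreover have "card (P - {A} - {B} \<union> {C, B - C}) \<le> card P"
      proof -
        \<comment> \<open>Two blocks replace \<open>B\<close>; the extra one is offset by the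
          dropped \<open>{w}\<close>.\<close>
        have "card {C, B - C} \<le> 2" by (simp add: card_insert_if)
        then show ?thesis
          using card_replace_le[of "P - {A}" B "{C, B - C}"] \<open>finite P\<close> B(1) card by simp
      qed
      ultimately show ?thesis by blast
    qed
  qed
qed

end

theorem theorem6p13:
  fixes G H :: "'a pair_pre_digraph" and u v w :: 'a
  assumes "pair_graph G"
    and "(u, v) \<in> parcs G"
    and "w \<notin> pverts G"
    and "H = subdivide G (u, v) w"
  shows "tree_cover_number (with_proj G) = tree_cover_number (with_proj H)"
proof -
  interpret G: pair_graph G by fact
  interpret H: pair_graph H
    unfolding assms(4) by (rule G.pair_graph_subdivide) fact+
  interpret edge_subdivision "parcs G" "pverts G" u v w
    using assms G.pair_finite_verts G.arcs_symmetric G.no_loops'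
    by unfold_locales (auto simp: sym_def dest: G.wellformed')
  \<comment> \<open>Identifies the library's \<open>subdivide\<close> with the relation of the
    locale, so that both transfer lemmas apply to minimum covers.\<close>
  have H: "parcs H = subdivided" "pverts H = insert w (pverts G)"
    by (auto simp: assms(4) subdivided_def)
  obtain P where "tree_partition (parcs G) (pverts G) P" "card P = tree_cover_number (with_proj G)"
    by (rule G.tree_cover_number_attained)
  then have "tree_cover_number (with_proj H) \<le> tree_cover_number (with_proj G)"
    using tree_partition_subdivided H.tree_cover_number_le unfolding H by (metis order_trans)
  moreover obtain Q where "tree_partition (parcs H) (pverts H) Q" "card Q = tree_cover_number (with_proj H)"
    by (rule H.tree_cover_number_attained)
  then have "tree_cover_number (with_proj G) \<le> tree_cover_number (with_proj H)"
    using tree_partition_unsubdivided G.tree_cover_number_le unfolding H by (metis order_trans)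
  ultimately show ?thesis by simp
qed

end
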